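(* There is a constant $\delta>0$, independent of $n$ and $\varepsilon$, such that the following holds. Let $G$ be the path on vertices $1,\dots,n$ with $n>3$, let $q=4$, and let $\Omega^+=\{0,1,2,3\}^n$ be the set of all (proper and improper) $4$-colorings of $G$. Let $\mathcal{M}_{\mathrm{Gl}}$ be the Glauber dynamics on the state space $\Omega^+$. Then for all $\varepsilon\in(0,1)$, $$\mathrm{Mix}(\mathcal{M}_{\mathrm{Gl}},\varepsilon)\ \le\ \frac{12}{\delta}\,n\log(n\varepsilon^{-1}).$$
   Context: The $n$-vertex path has vertices $1,\dots,n$ and edges $\{i,i+1\}$. A $q$-coloring is a vector $\sigma=(\sigma_1,\dots,\sigma_n)\in\{0,\dots,q-1\}^n$; it is proper if adjacent vertices receive different colors. The procedure Metropolis($v$), applied to any coloring in $\Omega^+$: choose a color $c\in\{0,\dots,q-1\}$ uniformly at random and propose recoloring $v$ with $c$; the proposal is accepted if and only if $c$ is not used at any neighbor of $v$ (otherwise the coloring is unchanged). One step of the Markov chain $\mathcal{M}_{\mathrm{Gl}}$ (Glauber dynamics): choose a vertex $v$ uniformly at random and do Metropolis($v$). The chain never moves from a proper coloring to an improper one; its stationary distribution is uniform on the set $\Omega$ of proper colorings and gives measure zero to $\Omega^+\setminus\Omega$. For a Markov chain $\mathcal{M}$ with transition matrix $P$ and stationary distribution $\pi$, $\mathrm{Mix}_x(\mathcal{M},\varepsilon)=\min\{t>0:\mathrm{d_{TV}}(P^t(x,\cdot),\pi(\cdot))\le\varepsilon\}$ and $\mathrm{Mix}(\mathcal{M},\varepsilon)=\max_x\mathrm{Mix}_x(\mathcal{M},\varepsilon)$,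 the maximum being over all initial states $x$ in the state space $\Omega^+$, where $\mathrm{d_{TV}}(\theta_1,\theta_2)=\frac12\sum_i|\theta_1(i)-\theta_2(i)|$. The logarithm is natural. *)

theory Defs
  imports "HOL-Probability.Probability"
begin

text \<open>
  A Markov chain is given by its transition kernel \<open>K\<close>: the transition matrix is
  \<open>P x y = pmf (K x) y\<close>, and \<open>P\<^sup>t(x, \<cdot>)\<close> is the following distribution.
\<close>

primrec kernel_power :: "('s \<Rightarrow> 's pmf) \<Rightarrow> nat \<Rightarrow> 's \<Rightarrow> 's pmf" where
  "kernel_power K 0 x = return_pmf x"
| "kernel_power K (Suc t) x = bind_pmf (kernel_power K t x) K"

definition stationary :: "('s \<Rightarrow> 's pmf) \<Rightarrow> 's pmf \<Rightarrow> bool" where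
  "stationary K \<pi> \<longleftrightarrow> bind_pmf \<pi> K = \<pi>"

definition tv_dist :: "'s set \<Rightarrow> 's pmf \<Rightarrow> 's pmf \<Rightarrow> real" where
  "tv_dist S \<theta>1 \<theta>2 = (1 / 2) * (\<Sum>i\<in>S. \<bar>pmf \<theta>1 i - pmf \<theta>2 i\<bar>)"

text \<open>
  Mixing times live in \<open>enat\<close>, so that the mixing time is \<open>\<infinity>\<close> (rather than an arbitrary number)
  if the threshold is never reached.
\<close>

definition mix_from :: "'s set \<Rightarrow> ('s \<Rightarrow> 's pmf) \<Rightarrow> 's pmf \<Rightarrow> 's \<Rightarrow> real \<Rightarrow> enat" where
  "mix_from S K \<pi> x \<epsilon> = (INF t\<in>{t. t > 0 \<and> tv_dist S (kernel_power K t x) \<pi> \<le> \<epsilon>}. enat t)"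

definition mix :: "'s set \<Rightarrow> ('s \<Rightarrow> 's pmf) \<Rightarrow> 's pmf \<Rightarrow> real \<Rightarrow> enat" where
  "mix S K \<pi> \<epsilon> = (SUP x\<in>S. mix_from S K \<pi> x \<epsilon>)"

text \<open>A graph is given by its vertex set and its set of edges, an edge being a two-element set.\<close>

type_synonym coloring = "nat \<Rightarrow> nat"

definition path_vertices :: "nat \<Rightarrow> nat set" where
  "path_vertices n = {1..n}"

definition path_edges :: "nat \<Rightarrow> nat set set" where
  "path_edges n = {{i, i + 1} |i. 1 \<le> i \<and> i < n}"

text \<open>Colorings are extended by \<open>undefined\<close> outside the vertex set.\<close>

definition colorings :: "nat set \<Rightarrow> nat \<Rightarrow> coloring set" where
  "colorings V q = V \<rightarrow>\<^sub>E {0..<q}"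

definition proper_colorings :: "nat set \<Rightarrow> nat set set \<Rightarrow> nat \<Rightarrow> coloring set" where
  "proper_colorings V E q = {\<sigma> \<in> colorings V q. \<forall>v w. {v, w} \<in> E \<longrightarrow> \<sigma> v \<noteq> \<sigma> w}"

definition metropolis :: "nat set set \<Rightarrow> nat \<Rightarrow> nat \<Rightarrow> coloring \<Rightarrow> coloring pmf" where
  "metropolis E q v \<sigma> =
     map_pmf (\<lambda>c. if \<forall>w. {v, w} \<in> E \<longrightarrow> \<sigma> w \<noteq> c then \<sigma>(v := c) else \<sigma>) (pmf_of_set {0..<q})"

definition glauber :: "nat set \<Rightarrow> nat set set \<Rightarrow> nat \<Rightarrow> coloring \<Rightarrow> coloring pmf" where
  "glauber V E q \<sigma> = bind_pmf (pmf_of_set V) (\<lambda>v. metropolis E q v \<sigma>)"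

lemma metropolis_stationary:
  assumes "finite V" "v \<in> V" "{v} \<notin> E" "q > 0" "proper_colorings V E q \<noteq> {}"
  shows "stationary (metropolis E q v) (pmf_of_set (proper_colorings V E q))"
proof -
  define A where "A = proper_colorings V E q"
  define C where "C = {0..<q}"
  define ok where "ok = (\<lambda>\<sigma> c. \<forall>w. {v, w} \<in> E \<longrightarrow> (\<sigma>::coloring) w \<noteq> c)"
  define h where "h = (\<lambda>(\<sigma>, c). if ok \<sigma> c then (\<sigma>(v := c), \<sigma> v) else (\<sigma>, c))"
  have finA: "finite A"
    using assms(1) unfolding A_def proper_colorings_def colorings_def by (simp add: finite_PiE)
  have neA: "A \<noteq> {}" and finC: "finite C" and neC: "C \<noteq> {}"
    using assms(4,5) by (auto simp: A_def C_def)
  have nb: "w \<noteq> v" if "{v, w} \<in> E" for w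
    using that assms(3) by auto
  have upd: "\<sigma>(v := c) \<in> A" if "\<sigma> \<in> A" "c \<in> C" "ok \<sigma> c" for \<sigma> c
    using that assms(2,3)
    unfolding A_def C_def ok_def proper_colorings_def colorings_def
    by (auto simp: PiE_iff extensional_def insert_commute)
  have rev: "\<sigma> v \<in> C" "ok (\<sigma>(v := c)) (\<sigma> v)" if "\<sigma> \<in> A" for \<sigma> c
    using that assms(2) nb
    unfolding A_def C_def ok_def proper_colorings_def colorings_def
    by (fastforce simp: PiE_iff)+
  have hh: "h x \<in> A \<times> C \<and> h (h x) = x" if "x \<in> A \<times> C" for x
    using that upd rev by (auto simp: h_def split: prod.splits)
  have "bij_betw h (A \<times> C) (A \<times> C)"
    using hh by (intro bij_betw_byWitness[where f' = h]) blast+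
  hence inv: "map_pmf h (pmf_of_set (A \<times> C)) = pmf_of_set (A \<times> C)"
    using finA neA finC neC by (intro map_pmf_of_set_bij_betw) simp_all
  have pair: "pmf_of_set (A \<times> C) = pair_pmf (pmf_of_set A) (pmf_of_set C)"
    using finA neA finC neC
    by (intro pmf_eqI) (simp add: split_paired_all pmf_pair indicator_def card_cartesian_product)
  have "bind_pmf (pmf_of_set A) (metropolis E q v) =
      map_pmf (fst \<circ> h) (pair_pmf (pmf_of_set A) (pmf_of_set C))"
    unfolding pair_pmf_def map_bind_pmf metropolis_def C_def[symmetric] map_pmf_def
      bind_assoc_pmf bind_return_pmf
    by (auto simp: h_def ok_def intro!: bind_pmf_cong)
  also have "\<dots> = map_pmf fst (map_pmf h (pmf_of_set (A \<times> C)))"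
    by (simp add: pair map_pmf_comp o_def)
  also have "\<dots> = pmf_of_set A"
    by (simp only: inv) (simp add: pair map_fst_pair_pmf)
  finally show ?thesis
    by (simp add: stationary_def A_def)
qed

lemma glauber_stationary:
  assumes "finite V" "V \<noteq> {}" "\<And>v. {v} \<notin> E" "q > 0" "proper_colorings V E q \<noteq> {}"
  shows "stationary (glauber V E q) (pmf_of_set (proper_colorings V E q))"
proof -
  let ?\<pi> = "pmf_of_set (proper_colorings V E q)"
  have "bind_pmf ?\<pi> (glauber V E q)
      = bind_pmf (pmf_of_set V) (\<lambda>v. bind_pmf ?\<pi> (metropolis E q v))"
    unfolding glauber_def by (rule bind_commute_pmf)
  also have "\<dots> = bind_pmf (pmf_of_set V) (\<lambda>v. ?\<pi>)"
    using assms metropolis_stationary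
    by (intro bind_pmf_cong) (auto simp: stationary_def)
  finally show ?thesis
    by (simp add: stationary_def)
qed

lemma path_glauber_stationary:
  assumes "n \<ge> 1" "q \<ge> 2"
  shows "stationary (glauber (path_vertices n) (path_edges n) q)
    (pmf_of_set (proper_colorings (path_vertices n) (path_edges n) q))"
proof (rule glauber_stationary)
  have "restrict (\<lambda>i. i mod 2) {1..n}
      \<in> proper_colorings (path_vertices n) (path_edges n) q"
    using assms
    by (auto simp: proper_colorings_def colorings_def path_vertices_def path_edges_def
        doubleton_eq_iff mod_Suc split: if_splits intro: less_le_trans[OF mod_less_divisor])
  thus "proper_colorings (path_vertices n) (path_edges n) q \<noteq> {}" by blast
qed (use assms in \<open>auto simp: path_vertices_def path_edges_def\<close>)

end

theory Submission
  imports Defs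
begin

text \<open>
  The proof is a path coupling argument, carried out on functions instead of pairs of chains.
  Two colorings are joined by an edge if they differ at one vertex, each edge carries a weight
  between \<open>29/30\<close> and \<open>1\<close>, and a function is called Lipschitz if along each edge it
  changes by at most the weight. If averaging over one step of the chain multiplies the Lipschitz
  constant by \<open>r < 1\<close>, then it contracts the oscillation of every function, and testing
  against the sign of \<open>P\<^sup>t(x, \<cdot>) - \<pi>\<close> bounds the total variation distance by a
  constant times \<open>n r\<^sup>t\<close> (\<open>tv_dist_le_lipschitz_contraction\<close>). Here
  \<open>r = 1 - 1/(27000 n)\<close>, and \<open>O(n log (n/\<epsilon>))\<close> steps suffice.

  With unit weights the contraction just fails at four colors and maximum degree two. Suppose that
  the colorings \<open>\<sigma>\<close> and \<open>\<tau>\<close> differ only at \<open>v\<close>. Recoloring \<open>v\<close> removes the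
  difference for at least two of the four colors, and each of the two neighbors of \<open>v\<close> can
  acquire a new difference for at most one of the four colors, so gain and loss can balance. There is a strict
  gain if \<open>v\<close> is an end of the path or if its neighbors have the same color, because then three
  colors are good for \<open>v\<close>. Any other edge can be brought into this situation by at most three moves
  that change both colorings alike: give \<open>v - 1\<close> a color different from the two colors at
  \<open>v\<close>; make the color of \<open>v + 2\<close> different from that of \<open>v - 1\<close>; then give
  \<open>v + 1\<close> the color of \<open>v - 1\<close>. The weight of an edge records how far along this sequence it
  is. Each move lowers the weight, and the decrements \<open>1/30, 1/450, 1/6750\<close> from \<open>1\<close> shrink
  by a factor of \<open>15\<close> per stage, which makes the gain from the next useful move exceed all
  the losses, at most \<open>14\<close> times the current decrement, from other updates near \<open>v\<close>
  (\<open>sum_gap_contracts\<close>). Improper colorings need no separate treatment, as the first move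
  also applies when a color at \<open>v\<close> recurs at \<open>v - 1\<close>.
\<close>

section \<open>Mixing from contraction of a Lipschitz constant\<close>

definition avg :: "('s \<Rightarrow> 's pmf) \<Rightarrow> ('s \<Rightarrow> real) \<Rightarrow> 's \<Rightarrow> real" where
  "avg K f x = measure_pmf.expectation (K x) f"

text \<open>
  The edges are an index family with two end points, so that several edges with different weights
  may join the same states.
\<close>

definition edge_lipschitz ::
    "'i set \<Rightarrow> ('i \<Rightarrow> 's) \<Rightarrow> ('i \<Rightarrow> 's) \<Rightarrow> ('i \<Rightarrow> real) \<Rightarrow> real \<Rightarrow> ('s \<Rightarrow> real) \<Rightarrow> bool" where
  "edge_lipschitz I src dst w L f \<longleftrightarrow> (\<forall>i\<in>I. \<bar>f (src i) - f (dst i)\<bar> \<le> L * w i)"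

lemma edge_lipschitz_scale:
  assumes "edge_lipschitz I src dst w L f" "c \<ge> 0"
  shows "edge_lipschitz I src dst w (c * L) (\<lambda>x. c * f x)"
proof -
  have "\<bar>c * f a - c * f b\<bar> = c * \<bar>f a - f b\<bar>" for a b
    using assms(2) by (simp flip: right_diff_distrib add: abs_mult)
  thus ?thesis
    using assms by (auto simp: edge_lipschitz_def mult.assoc intro!: mult_left_mono)
qed

lemma avg_scale: "avg K (\<lambda>x. c * f x) = (\<lambda>x. c * avg K f x)"
  by (simp add: avg_def fun_eq_iff)

lemma set_kernel_power:
  assumes "\<forall>x\<in>S. set_pmf (K x) \<subseteq> S" "x \<in> S"
  shows "set_pmf (kernel_power K t x) \<subseteq> S"
  using assms by (induction t) (auto simp: set_bind_pmf)

lemma expectation_bind_kernel: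
  assumes "finite S" "\<forall>x\<in>S. set_pmf (K x) \<subseteq> S" "set_pmf p \<subseteq> S"
  shows "measure_pmf.expectation (bind_pmf p K) f = measure_pmf.expectation p (avg K f)"
proof -
  have "measure_pmf.expectation (bind_pmf p K) f = (\<Sum>a\<in>S. pmf p a *\<^sub>R avg K f a)"
    unfolding avg_def using assms by (intro pmf_expectation_bind) (auto intro: finite_subset)
  also have "\<dots> = measure_pmf.expectation p (avg K f)"
    using assms by (subst integral_measure_pmf[of S]) auto
  finally show ?thesis .
qed

lemma expectation_kernel_power:
  assumes "finite S" "\<forall>x\<in>S. set_pmf (K x) \<subseteq> S" "x \<in> S"
  shows "measure_pmf.expectation (kernel_power K t x) f = (avg K ^^ t) f x"
proof (induction t arbitrary: f)
  case (Suc t)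
  have "measure_pmf.expectation (kernel_power K (Suc t) x) f
      = measure_pmf.expectation (kernel_power K t x) (avg K f)"
    using assms by (simp add: expectation_bind_kernel[OF assms(1,2)] set_kernel_power)
  thus ?case
    by (simp add: Suc funpow_swap1)
qed simp

lemma expectation_stationary:
  assumes "finite S" "\<forall>x\<in>S. set_pmf (K x) \<subseteq> S" "set_pmf \<pi> \<subseteq> S" "stationary K \<pi>"
  shows "measure_pmf.expectation \<pi> ((avg K ^^ t) f) = measure_pmf.expectation \<pi> f"
proof (induction t arbitrary: f)
  case (Suc t)
  have "measure_pmf.expectation \<pi> (avg K f) = measure_pmf.expectation \<pi> f"
    using expectation_bind_kernel[OF assms(1,2,3), where f = f] assms(4) by (simp add: stationary_def)
  thus ?case
    by (simp add: Suc funpow_swap1)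
qed simp

text \<open>
  The hypothesis concerns the constant \<open>1\<close> only; linearity of the averaging operator extends it
  to every positive constant, which is what the iteration needs.
\<close>

lemma edge_lipschitz_avg_power:
  assumes contr: "\<And>f. edge_lipschitz I src dst w 1 f \<Longrightarrow> edge_lipschitz I src dst w r (avg K f)"
    and "r > 0" "edge_lipschitz I src dst w 1 f"
  shows "edge_lipschitz I src dst w (r ^ t) ((avg K ^^ t) f)"
proof (induction t)
  case (Suc t)
  let ?g = "(avg K ^^ t) f"
  have "edge_lipschitz I src dst w 1 (\<lambda>x. inverse (r ^ t) * ?g x)"
    using edge_lipschitz_scale[OF Suc, of "inverse (r ^ t)"] \<open>r > 0\<close> by simp
  hence "edge_lipschitz I src dst w r (\<lambda>x. inverse (r ^ t) * avg K ?g x)"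
    using contr by (simp flip: avg_scale)
  from edge_lipschitz_scale[OF this, of "r ^ t"] show ?case
    using \<open>r > 0\<close> by (simp add: mult_ac flip: mult.assoc)
qed (use assms in simp)

text \<open>
  A function with values in \<open>[-m/2, m/2]\<close> changes by at most \<open>m\<close>, hence by at most the weight,
  along every edge. For the rescaled sign of \<open>P\<^sup>t(x, \<cdot>) - \<pi>\<close>, the difference of its
  expectations under the two distributions is \<open>m\<close> times their distance. By stationarity it is
  also an average of the differences \<open>g x - g y\<close> with \<open>g\<close> the \<open>t\<close>-step average, whose
  Lipschitz constant is \<open>r\<^sup>t\<close>.
\<close>

theorem tv_dist_le_lipschitz_contraction:
  assumes S: "finite S" "\<forall>x\<in>S. set_pmf (K x) \<subseteq> S"
    and \<pi>: "set_pmf \<pi> \<subseteq> S" "stationary K \<pi>"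
    and contr: "\<And>f. edge_lipschitz I src dst w 1 f \<Longrightarrow> edge_lipschitz I src dst w r (avg K f)"
    and r: "r > 0"
    and m: "m > 0" "\<And>i. i \<in> I \<Longrightarrow> m \<le> w i"
    and diam: "\<And>f x y. edge_lipschitz I src dst w 1 f \<Longrightarrow> x \<in> S \<Longrightarrow> y \<in> S \<Longrightarrow> \<bar>f x - f y\<bar> \<le> D"
    and x: "x \<in> S"
  shows "tv_dist S (kernel_power K t x) \<pi> \<le> D / m * r ^ t"
proof -
  let ?p = "kernel_power K t x"
  define f where "f = (\<lambda>i. m / 2 * sgn (pmf ?p i - pmf \<pi> i))"
  define g where "g = (avg K ^^ t) f"
  have "\<bar>f a - f b\<bar> \<le> m" for a b
    using m(1) by (auto simp: f_def sgn_real_def)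
  hence "edge_lipschitz I src dst w 1 f"
    using m(2) by (force simp: edge_lipschitz_def intro: order_trans)
  hence "edge_lipschitz I src dst w (r ^ t) g"
    unfolding g_def using contr r by (intro edge_lipschitz_avg_power)
  from edge_lipschitz_scale[OF this, of "inverse (r ^ t)"] r
  have "edge_lipschitz I src dst w 1 (\<lambda>x. inverse (r ^ t) * g x)"
    by simp
  hence diam_g: "\<bar>inverse (r ^ t) * g x - inverse (r ^ t) * g y\<bar> \<le> D" if "y \<in> S" for y
    using diam x that by blast
  have g_diff: "g x - g y \<le> D * r ^ t" if "y \<in> S" for y
  proof -
    have "inverse (r ^ t) * (g x - g y) \<le> D"
      using diam_g[OF that] by (simp add: right_diff_distrib)
    thus ?thesis
      using r by (simp add: field_simps)
  qed
  have sum_pi: "(\<Sum>y\<in>S. pmf \<pi> y) = 1"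
    using S(1) \<pi>(1) by (rule sum_pmf_eq_1)
  have "m * tv_dist S ?p \<pi> = (\<Sum>i\<in>S. f i * pmf ?p i) - (\<Sum>i\<in>S. f i * pmf \<pi> i)"
    unfolding tv_dist_def sum_distrib_left sum_subtractf[symmetric]
    by (intro sum.cong) (auto simp: f_def sgn_real_def algebra_simps)
  also have "\<dots> = measure_pmf.expectation ?p f - measure_pmf.expectation \<pi> f"
    using S \<pi> x set_kernel_power[OF S(2) x, where t = t]
    by (subst (1 2) integral_measure_pmf_real[of S]) auto
  also have "\<dots> = g x - measure_pmf.expectation \<pi> g"
    unfolding g_def using S \<pi> x by (simp add: expectation_kernel_power expectation_stationary)
  also have "\<dots> = (\<Sum>y\<in>S. (g x - g y) * pmf \<pi> y)"
    using S \<pi> sum_pi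
    by (subst integral_measure_pmf_real[of S])
       (auto simp: left_diff_distrib sum_subtractf simp flip: sum_distrib_left)
  also have "\<dots> \<le> (\<Sum>y\<in>S. D * r ^ t * pmf \<pi> y)"
    using g_diff by (intro sum_mono mult_right_mono) auto
  also have "\<dots> = D * r ^ t"
    using sum_pi by (simp flip: sum_distrib_left)
  finally show ?thesis
    using m(1) by (simp add: field_simps)
qed

section \<open>One step of the chain on a path\<close>

definition all_colorings :: "nat \<Rightarrow> coloring set" where
  "all_colorings n = colorings (path_vertices n) 4"

definition free :: "nat \<Rightarrow> coloring \<Rightarrow> nat \<Rightarrow> nat \<Rightarrow> bool" where
  "free n \<sigma> v c \<longleftrightarrow> (1 < v \<longrightarrow> \<sigma> (v - 1) \<noteq> c) \<and> (v < n \<longrightarrow> \<sigma> (v + 1) \<noteq> c)"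

definition recolor :: "nat \<Rightarrow> coloring \<Rightarrow> nat \<Rightarrow> nat \<Rightarrow> coloring" where
  "recolor n \<sigma> v c = (if free n \<sigma> v c then \<sigma>(v := c) else \<sigma>)"

lemma finite_all_colorings: "finite (all_colorings n)"
  by (simp add: all_colorings_def colorings_def path_vertices_def finite_PiE)

lemma all_colorings_less: "\<sigma> \<in> all_colorings n \<Longrightarrow> v \<in> {1..n} \<Longrightarrow> \<sigma> v < 4"
  by (auto simp: all_colorings_def colorings_def path_vertices_def PiE_iff)

lemma all_colorings_outside: "\<sigma> \<in> all_colorings n \<Longrightarrow> v \<notin> {1..n} \<Longrightarrow> \<sigma> v = undefined"
  by (auto simp: all_colorings_def colorings_def path_vertices_def PiE_iff extensional_def)

lemma all_colorings_upd:
  "\<sigma> \<in> all_colorings n \<Longrightarrow> v \<in> {1..n} \<Longrightarrow> c < 4 \<Longrightarrow> \<sigma>(v := c) \<in> all_colorings n"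
  by (auto simp: all_colorings_def colorings_def path_vertices_def PiE_iff extensional_def)

lemma recolor_in_all_colorings:
  "\<sigma> \<in> all_colorings n \<Longrightarrow> v \<in> {1..n} \<Longrightarrow> c < 4 \<Longrightarrow> recolor n \<sigma> v c \<in> all_colorings n"
  by (simp add: recolor_def all_colorings_upd)

lemma metropolis_path:
  assumes "v \<in> {1..n}"
  shows "metropolis (path_edges n) q v \<sigma> = map_pmf (recolor n \<sigma> v) (pmf_of_set {0..<q})"
proof -
  have "{v, w} \<in> path_edges n \<longleftrightarrow> (1 < v \<and> w = v - 1) \<or> (v < n \<and> w = v + 1)" for w
    using assms by (auto simp: path_edges_def doubleton_eq_iff intro: exI[of _ "v - 1"])
  hence "(\<forall>w. {v, w} \<in> path_edges n \<longrightarrow> \<sigma> w \<noteq> c) \<longleftrightarrow> free n \<sigma> v c" for c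
    by (auto simp: free_def)
  thus ?thesis
    by (simp add: metropolis_def recolor_def[abs_def])
qed

abbreviation path_glauber :: "nat \<Rightarrow> coloring \<Rightarrow> coloring pmf" where
  "path_glauber n \<equiv> glauber (path_vertices n) (path_edges n) 4"

lemma avg_path_glauber:
  assumes "n \<ge> 1"
  shows "avg (path_glauber n) f \<sigma> = (\<Sum>u\<in>{1..n}. \<Sum>c\<in>{0..<4}. f (recolor n \<sigma> u c)) / (4 * real n)"
proof -
  have "avg (path_glauber n) f \<sigma>
      = (\<Sum>u\<in>{1..n}. measure_pmf.expectation (metropolis (path_edges n) 4 u \<sigma>) f / real n)"
    unfolding avg_def glauber_def path_vertices_def using assms
    by (subst pmf_expectation_bind_pmf_of_set) (auto simp: metropolis_path field_simps)
  also have "\<dots> = (\<Sum>u\<in>{1..n}. (\<Sum>c\<in>{0..<4}. f (recolor n \<sigma> u c)) / (4 * real n))"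
    by (intro sum.cong) (auto simp: metropolis_path integral_pmf_of_set)
  finally show ?thesis
    by (simp add: sum_divide_distrib)
qed

lemma set_path_glauber:
  assumes "n \<ge> 1" "\<sigma> \<in> all_colorings n"
  shows "set_pmf (path_glauber n \<sigma>) \<subseteq> all_colorings n"
  using assms by (auto simp: glauber_def path_vertices_def metropolis_path
    intro!: recolor_in_all_colorings)

section \<open>A weight for pairs of colorings that differ at one vertex\<close>

text \<open>
  The weight of the edge between \<open>\<sigma>\<close> and \<open>\<sigma>(v := b)\<close>. The four cases are the stages of the
  sequence of moves that ends with equally colored neighbors of \<open>v\<close>. In the order of that sequence
  they are: a color at \<open>v\<close> recurs at \<open>v - 1\<close> (weight \<open>1\<close>); otherwise, the color of
  \<open>v + 2\<close> prevents \<open>v + 1\<close> from taking the color of \<open>v - 1\<close> (\<open>1 - 1/6750\<close>); nothing prevents it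
  (\<open>1 - 1/450\<close>); the neighbors agree, or one of them is missing (\<open>1 - 1/30\<close>). Each decrement
  exceeds \<open>14\<close> times the previous one, as \<open>sum_gap_contracts\<close> requires.
\<close>

definition weight :: "nat \<Rightarrow> coloring \<Rightarrow> nat \<Rightarrow> nat \<Rightarrow> real" where
  "weight n \<sigma> v b =
    (if v = 1 \<or> v = n \<or> \<sigma> (v - 1) = \<sigma> (v + 1) then 1 - 1 / 30
     else if \<sigma> (v - 1) \<in> {\<sigma> v, b} then 1
     else if v + 2 \<le> n \<and> \<sigma> (v + 2) = \<sigma> (v - 1) then 1 - 1 / 6750
     else 1 - 1 / 450)"

lemma weight_le: "weight n \<sigma> v b \<le> 1" and weight_ge: "weight n \<sigma> v b \<ge> 29 / 30"
  by (simp_all add: weight_def)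

definition path_lipschitz :: "nat \<Rightarrow> real \<Rightarrow> (coloring \<Rightarrow> real) \<Rightarrow> bool" where
  "path_lipschitz n = edge_lipschitz (all_colorings n \<times> {1..n} \<times> {0..<4})
     fst (\<lambda>(\<sigma>, v, b). \<sigma>(v := b)) (\<lambda>(\<sigma>, v, b). weight n \<sigma> v b)"

lemma path_lipschitz_iff:
  "path_lipschitz n L f \<longleftrightarrow>
    (\<forall>\<sigma>\<in>all_colorings n. \<forall>v\<in>{1..n}. \<forall>b<4. \<bar>f \<sigma> - f (\<sigma>(v := b))\<bar> \<le> L * weight n \<sigma> v b)"
  by (force simp: path_lipschitz_def edge_lipschitz_def)

lemma exists_fourth_color: "\<exists>c<4. c \<noteq> x \<and> c \<noteq> y \<and> c \<noteq> (z :: nat)"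
proof -
  have "card {x, y, z} < card {0..<4::nat}"
    by (rule le_less_trans[OF card_insert_le_m1[of 3]]) (auto intro: card_insert_le_m1)
  hence "\<not> {0..<4} \<subseteq> {x, y, z}"
    using card_mono[of "{x, y, z}" "{0..<4}"] by auto
  thus ?thesis by auto
qed

section \<open>Expected change across one disagreement\<close>

locale single_disagreement =
  fixes n :: nat and f :: "coloring \<Rightarrow> real" and \<sigma> :: coloring and v b :: nat
  assumes lip: "path_lipschitz n 1 f"
    and \<sigma>: "\<sigma> \<in> all_colorings n" and v: "v \<in> {1..n}" and b: "b < 4"
begin

abbreviation \<tau> :: coloring where "\<tau> \<equiv> \<sigma>(v := b)"
abbreviation w :: real where "w \<equiv> weight n \<sigma> v b"

text \<open>
  Four times the difference of the expected values of \<open>f\<close> after an update at \<open>u\<close>. An upper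
  bound suffices, because the lower bound is the upper bound for \<open>-f\<close>. A vertex whose update
  has no effect on the disagreement contributes at most \<open>4 * w\<close>, and contraction means that the
  average over all vertices is smaller than that.
\<close>

definition gap :: "nat \<Rightarrow> real" where
  "gap u = (\<Sum>c\<in>{0..<4}. f (recolor n \<sigma> u c)) - (\<Sum>c\<in>{0..<4}. f (recolor n \<tau> u c))"

lemma lipD:
  assumes "\<rho> \<in> all_colorings n" "u \<in> {1..n}" "c < 4"
  shows "f \<rho> - f (\<rho>(u := c)) \<le> weight n \<rho> u c"
  using lip assms unfolding path_lipschitz_iff by fastforce

lemma lipD_1:
  assumes "\<rho> \<in> all_colorings n" "u \<in> {1..n}" "c < 4"
  shows "f \<rho> - f (\<rho>(u := c)) \<le> 1"
  using lipD[OF assms] weight_le[of n \<rho> u c] by linarith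

text \<open>
  A color accepted at \<open>v\<close> makes the colorings equal, and the neighbors of \<open>v\<close>, which decide on
  acceptance, have the same colors in both. So only the rejected colors contribute.
\<close>

lemma gap_self_card: "gap v \<le> card {c \<in> {0..<4}. \<not> free n \<sigma> v c} * w"
proof -
  have free: "free n \<tau> v c \<longleftrightarrow> free n \<sigma> v c" for c
    using v by (auto simp: free_def)
  have "gap v = (\<Sum>c\<in>{0..<4}. f (recolor n \<sigma> v c) - f (recolor n \<tau> v c))"
    by (simp only: gap_def sum_subtractf)
  also have "\<dots> \<le> (\<Sum>c\<in>{0..<4}. if \<not> free n \<sigma> v c then w else 0)"
    using lipD[OF \<sigma> v b] by (intro sum_mono) (auto simp: recolor_def free)
  also have "\<dots> = card {c \<in> {0..<4}. \<not> free n \<sigma> v c} * w"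
    by (simp add: sum.If_cases Int_def)
  finally show ?thesis .
qed

lemma gap_self: "gap v \<le> 2 * w"
proof -
  have "card {c \<in> {0..<4}. \<not> free n \<sigma> v c} \<le> card {\<sigma> (v - 1), \<sigma> (v + 1)}"
    by (intro card_mono) (auto simp: free_def)
  also have "\<dots> \<le> 2"
    by (rule card_insert_le_m1) auto
  finally have "real (card {c \<in> {0..<4}. \<not> free n \<sigma> v c}) * w \<le> 2 * w"
    using weight_ge[of n \<sigma> v b] by (intro mult_right_mono) auto
  thus ?thesis using gap_self_card by linarith
qed

lemma gap_self_one_neighbor_color:
  assumes "v = 1 \<or> v = n \<or> \<sigma> (v - 1) = \<sigma> (v + 1)"
  shows "gap v \<le> w"
proof -
  have "\<exists>x. {c \<in> {0..<4}. \<not> free n \<sigma> v c} \<subseteq> {x}"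
  proof (cases "v = n")
    case True
    thus ?thesis by (intro exI[of _ "\<sigma> (v - 1)"]) (auto simp: free_def)
  next
    case False
    thus ?thesis using assms by (intro exI[of _ "\<sigma> (v + 1)"]) (auto simp: free_def)
  qed
  then obtain x where "{c \<in> {0..<4}. \<not> free n \<sigma> v c} \<subseteq> {x}" ..
  hence "card {c \<in> {0..<4}. \<not> free n \<sigma> v c} \<le> 1"
    using card_mono[of "{x}"] by fastforce
  hence "real (card {c \<in> {0..<4}. \<not> free n \<sigma> v c}) * w \<le> 1 * w"
    using weight_ge[of n \<sigma> v b] by (intro mult_right_mono) auto
  thus ?thesis using gap_self_card by linarith
qed

lemma gap_nonadjacent:
  assumes u: "u \<in> {1..n}" "u \<noteq> v" "u + 1 \<noteq> v" "u \<noteq> v + 1"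
  shows "gap u \<le> (\<Sum>c\<in>{0..<4}. weight n (recolor n \<sigma> u c) v b)"
proof -
  have "free n \<tau> u c \<longleftrightarrow> free n \<sigma> u c" for c
    using u by (auto simp: free_def)
  hence rec: "recolor n \<tau> u c = (recolor n \<sigma> u c)(v := b)" for c
    using fun_upd_twist[OF u(2), of \<sigma> c b, symmetric] by (simp only: recolor_def split: if_split) simp
  show ?thesis
    unfolding gap_def sum_subtractf[symmetric] rec
    using \<sigma> u v b by (intro sum_mono lipD recolor_in_all_colorings) auto
qed

text \<open>
  The weight looks only at the colors of \<open>v - 1\<close>, \<open>v\<close>, \<open>v + 1\<close> and \<open>v + 2\<close>.
\<close>

lemma gap_far:
  assumes u: "u \<in> {1..n}" "u \<noteq> v" "u + 1 \<noteq> v" "u \<noteq> v + 1" "u \<noteq> v + 2"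
  shows "gap u \<le> 4 * w"
proof -
  have "recolor n \<sigma> u c x = \<sigma> x" if "x \<in> {v - 1, v, v + 1, v + 2}" for x c
    using that u v by (auto simp: recolor_def)
  hence "weight n (recolor n \<sigma> u c) v b = w" for c
    by (simp add: weight_def)
  thus ?thesis
    using gap_nonadjacent[OF u(1-4)] by simp
qed

text \<open>
  The color \<open>c0\<close> stands for the useful move, whose effect on the weight is kept; the other three
  colors are estimated by the largest weight \<open>1\<close>.
\<close>

lemma gap_second_neighbor:
  assumes u: "u = v + 2" "u \<le> n" and c0: "c0 < 4" "free n \<sigma> u c0"
  shows "gap u \<le> 3 + weight n (\<sigma>(u := c0)) v b"
proof -
  have "gap u \<le> (\<Sum>c\<in>{0..<4}. weight n (recolor n \<sigma> u c) v b)"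
    using u v by (intro gap_nonadjacent) auto
  also have "\<dots> \<le> (\<Sum>c\<in>{0..<4}. 1 + (if c = c0 then weight n (\<sigma>(u := c0)) v b - 1 else 0))"
    using c0 weight_le by (intro sum_mono) (auto simp: recolor_def)
  also have "\<dots> = 3 + weight n (\<sigma>(u := c0)) v b"
    using c0 by (simp add: sum.distrib sum.delta)
  finally show ?thesis .
qed

lemma gap_second_neighbor_le:
  assumes u: "u = v + 2" "u \<le> n"
  shows "gap u \<le> 4"
proof -
  obtain c where "c < 4" "c \<noteq> \<sigma> (u - 1)" "c \<noteq> \<sigma> (u + 1)"
    using exists_fourth_color by metis
  thus ?thesis
    using gap_second_neighbor[OF u, of c] weight_le[of n "\<sigma>(u := c)" v b]
    by (auto simp: free_def)
qed

text \<open>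
  The proposals of the two colorings at a neighbor \<open>u\<close> of \<open>v\<close> are matched so that a second
  disagreement arises for only one of the four colors. That color costs at most \<open>2\<close>, for two edges,
  the others at most \<open>1\<close>. The proposals \<open>a\<close> and \<open>b\<close>, the colors at \<open>v\<close>, are
  exchanged if the other neighbor of \<open>u\<close> has neither color: proposing \<open>a\<close> to \<open>\<sigma>\<close> and \<open>b\<close> to
  \<open>\<tau>\<close> is then rejected by both. If the other neighbor does have one of these colors, it blocks that
  proposal in both colorings, and identical proposals differ in effect only for the other one. In either
  case the color \<open>c0\<close>, accepted by both, is proposed to both.
\<close>

lemma gap_neighbor:
  assumes u: "u \<in> {1..n}" "u + 1 = v \<or> u = v + 1"
    and c0: "c0 < 4" "free n \<sigma> u c0" "free n \<tau> u c0"
  shows "gap u \<le> 4 + weight n (\<sigma>(u := c0)) v b"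
proof -
  define a where "a = \<sigma> v"
  have a: "a < 4" and neq: "u \<noteq> v" using \<sigma> v u by (auto simp: a_def intro: all_colorings_less)
  \<comment> \<open>\<open>R c\<close> says that the neighbor of \<open>u\<close> other than \<open>v\<close> permits the color \<open>c\<close>.\<close>
  define R where "R = (\<lambda>c. if u + 1 = v then 1 < u \<longrightarrow> \<sigma> (u - 1) \<noteq> c else u < n \<longrightarrow> \<sigma> (u + 1) \<noteq> c)"
  have free: "free n \<sigma> u c \<longleftrightarrow> c \<noteq> a \<and> R c" "free n \<tau> u c \<longleftrightarrow> c \<noteq> b \<and> R c" for c
    using u v by (auto simp: free_def R_def a_def)
  define p where "p = (if R a \<and> R b then Transposition.transpose a b else id)"
  define bad where "bad = (if R b then b else a)"
  have p: "p permutes {0..<4}"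
    using a b by (auto simp: p_def permutes_id intro: permutes_swap_id)
  have "c0 \<noteq> bad"
    using c0 by (auto simp: free bad_def)
  have rec_upd: "\<exists>e<4. recolor n \<rho> u c = \<rho>(u := e)" if "\<rho> \<in> all_colorings n" "c < 4" for \<rho> c
    using that u all_colorings_less[of \<rho> n u]
    by (cases "free n \<rho> u c") (auto simp: recolor_def intro: exI[of _ "\<rho> u"])
  have pair_good: "f (recolor n \<sigma> u c) - f (recolor n \<tau> u (p c)) \<le> weight n (recolor n \<sigma> u c) v b"
    if "c < 4" "c \<noteq> bad" for c
  proof -
    have same: "free n \<sigma> u c \<longleftrightarrow> free n \<tau> u (p c)" "free n \<sigma> u c \<Longrightarrow> p c = c"
      using that(2) by (auto simp: free p_def bad_def Transposition.transpose_def split: if_splits)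
    have "recolor n \<tau> u (p c) = (recolor n \<sigma> u c)(v := b)"
      using same fun_upd_twist[OF neq, of \<sigma> c b, symmetric]
      by (cases "free n \<sigma> u c") (simp_all only: recolor_def if_True if_False simp_thms)
    thus ?thesis
      using lipD[OF recolor_in_all_colorings[OF \<sigma> u(1) that(1)] v b] by simp
  qed
  have pair_any: "f (recolor n \<sigma> u c) - f (recolor n \<tau> u d) \<le> 2" if cd: "c < 4" "d < 4" for c d
  proof -
    \<comment> \<open>A rejected proposal amounts to recoloring \<open>u\<close> with its present color, so both results are
      recolorings of \<open>u\<close>, joined by an edge at \<open>v\<close> followed by an edge at \<open>u\<close>.\<close>
    obtain e e' where e: "e < 4" "recolor n \<sigma> u c = \<sigma>(u := e)"
      and e': "e' < 4" "recolor n \<tau> u d = \<tau>(u := e')"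
      using rec_upd[OF \<sigma> cd(1)] rec_upd[OF all_colorings_upd[OF \<sigma> v b] cd(2)] by blast
    have "f (\<sigma>(u := e)) - f (\<sigma>(u := e, v := b)) \<le> 1"
      using \<sigma> u v b e by (intro lipD_1 all_colorings_upd) auto
    moreover have "f (\<tau>(u := e)) - f (\<tau>(u := e, u := e')) \<le> 1"
      using \<sigma> u v b e e' by (intro lipD_1 all_colorings_upd) auto
    moreover have "\<sigma>(u := e, v := b) = \<tau>(u := e)" 
      by (rule fun_upd_twist[OF neq])
    ultimately show ?thesis
      using e e' by simp
  qed
  have p_less: "p c < 4" if "c < 4" for c
    using permutes_in_image[OF p, of c] that by simp
  have "gap u = (\<Sum>c\<in>{0..<4}. f (recolor n \<sigma> u c) - f (recolor n \<tau> u (p c)))"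
    unfolding gap_def sum_subtractf by (subst (2) sum.permute[OF p]) (simp add: o_def)
  also have "\<dots> \<le> (\<Sum>c\<in>{0..<4}. 1 + (if c = c0 then weight n (\<sigma>(u := c0)) v b - 1 else 0)
                              + (if c = bad then 1 else 0))"
  proof (intro sum_mono)
    fix c :: nat assume "c \<in> {0..<4}"
    hence c: "c < 4" by simp
    show "f (recolor n \<sigma> u c) - f (recolor n \<tau> u (p c))
        \<le> 1 + (if c = c0 then weight n (\<sigma>(u := c0)) v b - 1 else 0) + (if c = bad then 1 else 0)"
      using pair_good[OF c] pair_any[OF c p_less[OF c]] c0(2) \<open>c0 \<noteq> bad\<close>
        weight_le[of n "recolor n \<sigma> u c" v b]
      by (auto simp: recolor_def split: if_splits)
  qed
  also have "\<dots> \<le> 4 + weight n (\<sigma>(u := c0)) v b"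
    using c0(1) a b by (simp add: sum.distrib sum.delta bad_def)
  finally show ?thesis .
qed

lemma gap_neighbor_le:
  assumes u: "u \<in> {1..n}" "u + 1 = v \<or> u = v + 1"
  shows "gap u \<le> 5"
proof -
  have "u - Suc 0 \<noteq> Suc u" by arith
  define z where "z = (if u + 1 = v then u - 1 else u + 1)"
  obtain c where "c < 4" "c \<noteq> \<sigma> v" "c \<noteq> b" "c \<noteq> \<sigma> z"
    using exists_fourth_color by metis
  thus ?thesis
    using gap_neighbor[OF u, of c] weight_le[of n "\<sigma>(u := c)" v b] u
      \<open>u - Suc 0 \<noteq> Suc u\<close>
    by (auto simp: free_def z_def split: if_splits)
qed

text \<open>
  The numbers \<open>e, e1, e2, e3\<close> are the excesses over \<open>4 * w\<close> at \<open>v\<close>, \<open>v - 1\<close>, \<open>v + 1\<close> and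
  \<open>v + 2\<close>. A vertex outside the path contributes no gap, and its excess may be added to the bound as
  long as it is nonnegative.
\<close>

lemma sum_gap_le:
  assumes "gap v \<le> 4 * w + e"
    and "v > 1 \<Longrightarrow> gap (v - 1) \<le> 4 * w + e1" "v > 1 \<or> e1 \<ge> 0"
    and "v < n \<Longrightarrow> gap (v + 1) \<le> 4 * w + e2" "v < n \<or> e2 \<ge> 0"
    and "v + 2 \<le> n \<Longrightarrow> gap (v + 2) \<le> 4 * w + e3" "v + 2 \<le> n \<or> e3 \<ge> 0"
  shows "(\<Sum>u\<in>{1..n}. gap u) \<le> 4 * real n * w + (e + e1 + e2 + e3)"
proof -
  have "(\<Sum>u\<in>{1..n}. gap u) \<le> (\<Sum>u\<in>{1..n}. 4 * w + ((if u = v then e else 0)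
      + (if u = v - 1 then e1 else 0) + (if u = v + 1 then e2 else 0) + (if u = v + 2 then e3 else 0)))"
  proof (intro sum_mono)
    fix u assume u: "u \<in> {1..n}"
    show "gap u \<le> 4 * w + ((if u = v then e else 0)
      + (if u = v - 1 then e1 else 0) + (if u = v + 1 then e2 else 0) + (if u = v + 2 then e3 else 0))"
      using u v assms gap_far[OF u] by (cases "u = v - 1") auto
  qed
  also have "\<dots> \<le> 4 * real n * w + (e + e1 + e2 + e3)"
    using v assms(3,5,7) by (auto simp: sum.distrib sum.delta)
  finally show ?thesis .
qed

text \<open>
  The excesses over \<open>4 * w\<close> are at most \<open>- 2 * w\<close> at \<open>v\<close>, \<open>5 - 4 * w\<close> at each neighbor and
  \<open>4 - 4 * w\<close> at \<open>v + 2\<close>, in total \<open>14 * (1 - w)\<close>. If the neighbors of \<open>v\<close> agree or one is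
  missing, there is an additional \<open>- w\<close>, which dominates. Otherwise one of the
  local moves leads to the next stage, and the decrement of its weight from \<open>1\<close> is at least \<open>15 * (1 - w)\<close>, or
  \<open>1/6750\<close> if \<open>w = 1\<close>. Subtracting it from the total leaves a net loss of at least \<open>1/6750\<close>.
\<close>

lemma sum_gap_contracts:
  "(\<Sum>u\<in>{1..n}. gap u) \<le> 4 * real n * w - 1 / 6750"
proof -
  have left: "gap (v - 1) \<le> 5" if "v > 1"
    using that v by (intro gap_neighbor_le) auto
  have right: "gap (v + 1) \<le> 5" if "v < n"
    using that v by (intro gap_neighbor_le) auto
  have right2: "gap (v + 2) \<le> 4" if "v + 2 \<le> n"
    using that v by (intro gap_second_neighbor_le) auto
  note w_le = weight_le[of n \<sigma> v b]
  consider (equal) "v = 1 \<or> v = n \<or> \<sigma> (v - 1) = \<sigma> (v + 1)"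
    | (clash) "1 < v" "v < n" "\<sigma> (v - 1) \<noteq> \<sigma> (v + 1)" "\<sigma> (v - 1) \<in> {\<sigma> v, b}"
    | (blocked) "1 < v" "v < n" "\<sigma> (v - 1) \<noteq> \<sigma> (v + 1)" "\<sigma> (v - 1) \<notin> {\<sigma> v, b}"
        "v + 2 \<le> n" "\<sigma> (v + 2) = \<sigma> (v - 1)"
    | (ready) "1 < v" "v < n" "\<sigma> (v - 1) \<noteq> \<sigma> (v + 1)" "\<sigma> (v - 1) \<notin> {\<sigma> v, b}"
        "\<not> (v + 2 \<le> n \<and> \<sigma> (v + 2) = \<sigma> (v - 1))"
    using v by fastforce
  thus ?thesis
  proof cases
    case equal
    hence w: "w = 29 / 30" by (simp add: weight_def)
    thus ?thesis
      using sum_gap_le[of "- 3 * w" "5 - 4 * w" "5 - 4 * w" "4 - 4 * w"]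
        gap_self_one_neighbor_color[OF equal] left right right2 by (simp add: w)
  next
    case clash
    hence w: "w = 1" by (auto simp: weight_def)
    \<comment> \<open>If \<open>v - 2\<close> is outside the path, its value is an arbitrary number, and avoiding it
      as well does no harm; the same holds for \<open>v + 3\<close> in the next case.\<close>
    obtain c where c: "c < 4" "c \<noteq> \<sigma> v" "c \<noteq> b" "c \<noteq> \<sigma> (v - 2)"
      using exists_fourth_color by metis
    have "gap (v - 1) \<le> 4 + weight n (\<sigma>(v - 1 := c)) v b"
      using c clash by (intro gap_neighbor) (auto simp: free_def numeral_2_eq_2)
    moreover have "v \<noteq> v - Suc 0" "Suc (Suc v) \<noteq> v - Suc 0"
      using clash by arith+
    hence "weight n (\<sigma>(v - 1 := c)) v b \<le> 1 - 1 / 6750"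
      using c clash by (simp add: weight_def)
    ultimately show ?thesis
      using sum_gap_le[of "- 2 * w" "1 - 1 / 6750" "5 - 4 * w" "4 - 4 * w"]
        gap_self right right2 clash by (simp add: w)
  next
    case blocked
    hence w: "w = 1 - 1 / 6750" by (auto simp: weight_def)
    obtain c where c: "c < 4" "c \<noteq> \<sigma> (v - 1)" "c \<noteq> \<sigma> (v + 1)" "c \<noteq> \<sigma> (v + 3)"
      using exists_fourth_color by metis
    have "gap (v + 2) \<le> 3 + weight n (\<sigma>(v + 2 := c)) v b"
      using c blocked by (intro gap_second_neighbor) (auto simp: free_def numeral_3_eq_3)
    moreover have "v - Suc 0 \<noteq> Suc (Suc v)"
      by arith
    hence "weight n (\<sigma>(v + 2 := c)) v b \<le> 1 - 1 / 450"
      using c blocked by (simp add: weight_def)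
    ultimately show ?thesis
      using sum_gap_le[of "- 2 * w" "5 - 4 * w" "5 - 4 * w" "4 - 1 / 450 - 4 * w"]
        gap_self left right blocked by (simp add: w)
  next
    case ready
    hence w: "w = 1 - 1 / 450" by (auto simp: weight_def)
    have c: "\<sigma> (v - 1) < 4"
      using ready by (intro all_colorings_less[OF \<sigma>]) auto
    have "gap (v + 1) \<le> 4 + weight n (\<sigma>(v + 1 := \<sigma> (v - 1))) v b"
      using c ready by (intro gap_neighbor) (auto simp: free_def)
    moreover have "weight n (\<sigma>(v + 1 := \<sigma> (v - 1))) v b = 1 - 1 / 30"
      by (simp add: weight_def)
    ultimately show ?thesis
      using sum_gap_le[of "- 2 * w" "5 - 4 * w" "5 - 1 / 30 - 4 * w" "4 - 4 * w"]
        gap_self left right2 ready by (simp add: w)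
  qed
qed

lemma avg_diff_le:
  "avg (path_glauber n) f \<sigma> - avg (path_glauber n) f \<tau> \<le> (1 - 1 / (27000 * real n)) * w"
proof -
  have n: "n \<ge> 1" using v by auto
  have "avg (path_glauber n) f \<sigma> - avg (path_glauber n) f \<tau> = (\<Sum>u\<in>{1..n}. gap u) / (4 * real n)"
    by (simp only: avg_path_glauber[OF n] gap_def sum_subtractf diff_divide_distrib)
  also have "\<dots> \<le> (4 * real n * w - 1 / 6750) / (4 * real n)"
    using sum_gap_contracts by (intro divide_right_mono) auto
  also have "\<dots> = w - 1 / (27000 * real n) * 1"
    using n by (simp add: field_simps)
  also have "\<dots> \<le> w - 1 / (27000 * real n) * w"
    using weight_le[of n \<sigma> v b] by (intro diff_left_mono mult_left_mono) auto
  finally show ?thesis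
    by (simp add: algebra_simps)
qed

end

section \<open>Mixing time of the path\<close>

lemma path_lipschitz_avg:
  assumes "path_lipschitz n 1 f"
  shows "path_lipschitz n (1 - 1 / (27000 * real n)) (avg (path_glauber n) f)"
  unfolding path_lipschitz_iff
proof (intro ballI allI impI)
  fix \<sigma> v and b :: nat
  assume *: "\<sigma> \<in> all_colorings n" "v \<in> {1..n}" "b < 4"
  have neg: "path_lipschitz n 1 (\<lambda>x. - f x)"
    using assms unfolding path_lipschitz_iff by (auto simp: abs_minus_commute)
  have "single_disagreement n f \<sigma> v b" "single_disagreement n (\<lambda>x. - f x) \<sigma> v b"
    using assms neg * by (simp_all add: single_disagreement_def)
  from this[THEN single_disagreement.avg_diff_le]
  show "\<bar>avg (path_glauber n) f \<sigma> - avg (path_glauber n) f (\<sigma>(v := b))\<bar>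
      \<le> (1 - 1 / (27000 * real n)) * weight n \<sigma> v b"
    using avg_scale[of "path_glauber n" "-1" f] by (simp add: abs_le_iff)
qed

text \<open>
  The colors of \<open>x\<close> are replaced by those of \<open>y\<close> one vertex at a time; the intermediate
  colorings may be improper, which is why the edges join all colorings.
\<close>

lemma path_lipschitz_diameter:
  assumes lip: "path_lipschitz n 1 f" and x: "x \<in> all_colorings n" and y: "y \<in> all_colorings n"
  shows "\<bar>f x - f y\<bar> \<le> real n"
proof -
  define z where "z = (\<lambda>k i. if i \<in> {1..k} then y i else x i)"
  have z_Suc: "z (Suc k) = (z k)(Suc k := y (Suc k))" for k
    by (auto simp: z_def fun_eq_iff)
  have "k \<le> n \<Longrightarrow> z k \<in> all_colorings n \<and> \<bar>f x - f (z k)\<bar> \<le> real k" for k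
  proof (induction k)
    case 0
    have "z 0 = x" by (auto simp: z_def fun_eq_iff)
    thus ?case using x by simp
  next
    case (Suc k)
    hence IH: "z k \<in> all_colorings n" "\<bar>f x - f (z k)\<bar> \<le> real k" and k: "Suc k \<in> {1..n}" by auto
    have y4: "y (Suc k) < 4" using all_colorings_less[OF y k] .
    have "\<bar>f (z k) - f (z (Suc k))\<bar> \<le> 1 * weight n (z k) (Suc k) (y (Suc k))"
      using lip IH(1) k y4 unfolding z_Suc path_lipschitz_iff by blast
    also have "\<dots> \<le> 1" using weight_le by simp
    finally show ?case
      using IH(2) all_colorings_upd[OF IH(1) k y4] unfolding z_Suc[symmetric] by auto
  qed
  moreover have "z n = y"
    using all_colorings_outside[OF x] all_colorings_outside[OF y] by (auto simp: z_def fun_eq_iff)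
  ultimately show ?thesis by force
qed

lemma tv_dist_path_glauber_le:
  assumes "n \<ge> 1" "x \<in> all_colorings n"
  shows "tv_dist (all_colorings n) (kernel_power (path_glauber n) t x)
      (pmf_of_set (proper_colorings (path_vertices n) (path_edges n) 4))
    \<le> 2 * real n * exp (- real t / (27000 * real n))"
proof -
  let ?P = "proper_colorings (path_vertices n) (path_edges n) 4"
  define r where "r = 1 - 1 / (27000 * real n)"
  have r: "r > 0" using assms by (simp add: r_def)
  have P: "?P \<subseteq> all_colorings n" "?P \<noteq> {}"
  proof -
    show "?P \<subseteq> all_colorings n" by (auto simp: proper_colorings_def all_colorings_def)
    have "restrict (\<lambda>i. i mod 2) {1..n} \<in> ?P"
      by (auto simp: proper_colorings_def colorings_def path_vertices_def path_edges_def
        doubleton_eq_iff mod_Suc split: if_splits intro: less_le_trans[OF mod_less_divisor])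
    thus "?P \<noteq> {}" by blast
  qed
  have "tv_dist (all_colorings n) (kernel_power (path_glauber n) t x) (pmf_of_set ?P)
      \<le> real n / (29 / 30) * r ^ t"
  proof (rule tv_dist_le_lipschitz_contraction[OF finite_all_colorings])
    show "\<forall>x\<in>all_colorings n. set_pmf (path_glauber n x) \<subseteq> all_colorings n"
      using set_path_glauber assms(1) by blast
    show "set_pmf (pmf_of_set ?P) \<subseteq> all_colorings n"
      using P finite_subset[OF P(1) finite_all_colorings] by simp
    show "stationary (path_glauber n) (pmf_of_set ?P)"
      using assms by (intro path_glauber_stationary) auto
    show "edge_lipschitz (all_colorings n \<times> {1..n} \<times> {0..<4}) fst (\<lambda>(\<sigma>, v, b). \<sigma>(v := b))
        (\<lambda>(\<sigma>, v, b). weight n \<sigma> v b) r (avg (path_glauber n) f)"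
      if "edge_lipschitz (all_colorings n \<times> {1..n} \<times> {0..<4}) fst (\<lambda>(\<sigma>, v, b). \<sigma>(v := b))
        (\<lambda>(\<sigma>, v, b). weight n \<sigma> v b) 1 f" for f
      using path_lipschitz_avg that unfolding path_lipschitz_def r_def .
    show "\<bar>f \<rho> - f \<rho>'\<bar> \<le> real n"
      if "edge_lipschitz (all_colorings n \<times> {1..n} \<times> {0..<4}) fst (\<lambda>(\<sigma>, v, b). \<sigma>(v := b))
        (\<lambda>(\<sigma>, v, b). weight n \<sigma> v b) 1 f" "\<rho> \<in> all_colorings n" "\<rho>' \<in> all_colorings n" for f \<rho> \<rho>'
      using path_lipschitz_diameter that unfolding path_lipschitz_def .
    show "29 / 30 \<le> (\<lambda>(\<sigma>, v, b). weight n \<sigma> v b) i" for i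
      using weight_ge[of n "fst i" "fst (snd i)" "snd (snd i)"] by (simp add: case_prod_beta)
  qed (use assms r in simp_all)
  also have "\<dots> \<le> 2 * real n * exp (- 1 / (27000 * real n)) ^ t"
    using r exp_ge_add_one_self[of "- 1 / (27000 * real n)"]
    by (intro mult_mono power_mono) (auto simp: r_def)
  also have "exp (- 1 / (27000 * real n)) ^ t = exp (- real t / (27000 * real n))"
    by (simp add: exp_of_nat_mult[symmetric])
  finally show ?thesis .
qed

text \<open>
  The bound \<open>2 * n * exp (- t / (27000 * n))\<close> drops to \<open>\<epsilon>\<close> at \<open>t = 27000 * n * ln (2 * n / \<epsilon>)\<close>.
  Since \<open>n / \<epsilon> \<ge> 4 > e\<close>, the logarithm \<open>l\<close> of \<open>n / \<epsilon>\<close> is at least \<open>1\<close>, so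
  the summand \<open>ln 2\<close> and rounding up to an integer are absorbed into \<open>81000 * n * l\<close>.
\<close>

theorem theorem12:
  "\<exists>\<delta>::real. \<delta> > 0 \<and>
    (\<forall>(n::nat) (\<epsilon>::real). n > 3 \<and> 0 < \<epsilon> \<and> \<epsilon> < 1 \<longrightarrow>
      ereal_of_enat
        (mix (colorings (path_vertices n) 4)
             (glauber (path_vertices n) (path_edges n) 4)
             (pmf_of_set (proper_colorings (path_vertices n) (path_edges n) 4))
             \<epsilon>)
      \<le> ereal (12 / \<delta> * real n * ln (real n * inverse \<epsilon>)))"
proof (intro exI[of _ "12 / 81000"] conjI allI impI)
  fix n :: nat and \<epsilon> :: real
  assume "n > 3 \<and> 0 < \<epsilon> \<and> \<epsilon> < 1"
  hence n: "n > 3" and \<epsilon>: "0 < \<epsilon>" "\<epsilon> < 1" by auto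
  let ?\<pi> = "pmf_of_set (proper_colorings (path_vertices n) (path_edges n) 4)"
  define l where "l = ln (real n * inverse \<epsilon>)"
  define t where "t = nat \<lceil>27000 * real n * (ln 2 + l)\<rceil>"
  have "4 \<le> real n * inverse \<epsilon>"
    using n \<epsilon> mult_mono[of 4 "real n" 1 "inverse \<epsilon>"] by (simp add: one_le_inverse)
  moreover have "exp 1 \<le> (4 :: real)"
    using exp_le by simp
  ultimately have l: "l \<ge> 1"
    unfolding l_def by (subst ln_ge_iff) auto
  have ln2: "0 < ln (2 :: real)" "ln (2 :: real) \<le> 1"
    using ln_le_minus_one[of 2] by auto
  have pos: "27000 * real n * (ln 2 + l) > 0"
    using n l ln2 by (intro mult_pos_pos add_pos_pos) auto
  hence t_pos: "t > 0"
    by (simp add: t_def)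
  have t_ge: "real t \<ge> 27000 * real n * (ln 2 + l)"
    unfolding t_def by (rule real_nat_ceiling_ge)
  have "tv_dist (all_colorings n) (kernel_power (path_glauber n) t x) ?\<pi> \<le> \<epsilon>" if "x \<in> all_colorings n" for x
  proof -
    have "exp (ln 2 + l) = 2 * real n / \<epsilon>"
      using n \<epsilon> by (simp add: l_def exp_add divide_inverse)
    hence exp_eq: "exp (- (ln 2 + l)) = \<epsilon> / (2 * real n)"
      unfolding exp_minus by simp
    have "tv_dist (all_colorings n) (kernel_power (path_glauber n) t x) ?\<pi>
        \<le> 2 * real n * exp (- real t / (27000 * real n))"
      using n that by (intro tv_dist_path_glauber_le) auto
    also have "\<dots> \<le> 2 * real n * exp (- (ln 2 + l))"
      using t_ge n by (intro mult_left_mono) (auto simp: field_simps)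
    also have "\<dots> = \<epsilon>"
      unfolding exp_eq using n by simp
    finally show ?thesis .
  qed
  hence "mix (all_colorings n) (path_glauber n) ?\<pi> \<epsilon> \<le> enat t"
    unfolding mix_def mix_from_def using t_pos by (intro SUP_least INF_lower) auto
  hence "ereal_of_enat (mix (all_colorings n) (path_glauber n) ?\<pi> \<epsilon>) \<le> ereal_of_enat (enat t)"
    by (simp only: ereal_of_enat_le_iff)
  also have "\<dots> = ereal (real t)"
    by simp
  also have "real t \<le> 12 / (12 / 81000) * real n * l"
  proof -
    have "real t \<le> 27000 * real n * (ln 2 + l) + 1"
      using pos unfolding t_def by linarith
    also have "\<dots> \<le> 27000 * real n * (l + l) + real n * l"
      using ln2 l n mult_mono[of 1 "real n" 1 l] by (intro add_mono mult_left_mono) auto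
    also have "\<dots> \<le> 81000 * real n * l"
      using l by (simp add: algebra_simps)
    finally show ?thesis by simp
  qed
  finally show "ereal_of_enat (mix (colorings (path_vertices n) 4) (path_glauber n) ?\<pi> \<epsilon>)
      \<le> ereal (12 / (12 / 81000) * real n * ln (real n * inverse \<epsilon>))"
    by (simp add: all_colorings_def l_def)
qed simp

end
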